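(* Let $\mathbf P_0=(P_0,\leq,{}',0,1)$ be the 18-element structure with pairwise distinct elements $0,a,b,c,d,e,f,g,h,a',b',c',d',e',f',g',h',1$, where the unary operation $'$ interchanges $x$ and $x'$ for each $x\in\{a,b,c,d,e,f,g,h\}$ and interchanges $0$ and $1$, and where $\leq$ is the partial order in which $0$ is the least element, $1$ is the greatest element, and the only other strict relations are $$a<d',f',g',h';\quad b<c',e',g',h';\quad c<b',h';\quad d<a',h';$$ $$e<b',g';\quad f<a',g';\quad g<a',b',e',f';\quad h<a',b',c',d'.$$ Then $\mathbf P_0$ is the smallest non-lattice orthomodular poset and it is unique up to isomorphism; that is: $\mathbf P_0$ is an orthomodular poset that is not a lattice, every orthomodular poset that is not a lattice has at least $18$ elements, and every orthomodular poset that is not a lattice and has exactly $18$ elements is isomorphic to $\mathbf P_0$.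
   Context: An orthomodular poset is a bounded poset $(P,\leq,{}',0,1)$ (least element $0$, greatest element $1$) with a unary operation $'$ that is an antitone involution ($x\leq y$ implies $y'\leq x'$, and $x''=x$) and a complementation (for every $x$, the only common lower bound of $x$ and $x'$ is $0$ and the only common upper bound is $1$), satisfying: (i) if $x\leq y'$ then the supremum $x\vee y$ exists; (ii) if $x\leq y$ then $y=x\vee(y\wedge x')$. (The expression in (ii) is well-defined by (i) and De Morgan's laws.) An orthomodular poset is called non-lattice if its underlying poset is not a lattice. An isomorphism is an order isomorphism that also preserves $'$. *)

theory Defs
  imports "HOL-Algebra.Lattice"
begin

section \<open>Orthomodular posets\<close>

record 'a ortho_struct = "'a gorder" +
  ocompl :: "'a \<Rightarrow> 'a"  (\<open>\<sim>\<index> _\<close> [81] 80)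
  zero_el :: 'a
  one_el :: 'a

text \<open>
  The library's \<open>\<squnion>\<close> and \<open>\<sqinter>\<close> are choice terms, meaningful only when the bound exists.
  In the law \<open>orthomodular\<close> both do; see \<open>orthomodular_meet\<close> and \<open>orthomodular_join\<close> below.
\<close>

locale orthomodular_poset = partial_order P for P (structure) +
  assumes zero_least: "least P (zero_el P) (carrier P)"
    and one_greatest: "greatest P (one_el P) (carrier P)"
    and ocompl_closed: "x \<in> carrier P \<Longrightarrow> \<sim> x \<in> carrier P"
    and ocompl_antitone: "\<lbrakk>x \<in> carrier P; y \<in> carrier P; x \<sqsubseteq> y\<rbrakk> \<Longrightarrow> \<sim> y \<sqsubseteq> \<sim> x"
    and ocompl_involution: "x \<in> carrier P \<Longrightarrow> \<sim> (\<sim> x) = x"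
    and ocompl_lower: "x \<in> carrier P \<Longrightarrow> Lower P {x, \<sim> x} = {zero_el P}"
    and ocompl_upper: "x \<in> carrier P \<Longrightarrow> Upper P {x, \<sim> x} = {one_el P}"
    and orthogonal_join_exists:
      "\<lbrakk>x \<in> carrier P; y \<in> carrier P; x \<sqsubseteq> \<sim> y\<rbrakk> \<Longrightarrow> \<exists>s. least P s (Upper P {x, y})"
    and orthomodular:
      "\<lbrakk>x \<in> carrier P; y \<in> carrier P; x \<sqsubseteq> y\<rbrakk> \<Longrightarrow> y = x \<squnion> (y \<sqinter> \<sim> x)"
begin

lemma orthomodular_meet:
  assumes x: "x \<in> carrier P" and y: "y \<in> carrier P" and le: "x \<sqsubseteq> y"
  shows "greatest P (y \<sqinter> \<sim> x) (Lower P {y, \<sim> x})"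
proof -
  have "\<sim> y \<sqsubseteq> \<sim> x" using ocompl_antitone[OF x y le] .
  then obtain s where s: "least P s (Upper P {\<sim> y, x})"
    using orthogonal_join_exists[of "\<sim> y" x] x y ocompl_closed by blast
  then have sc: "s \<in> carrier P" and up: "\<sim> y \<sqsubseteq> s" "x \<sqsubseteq> s"
    and min: "\<And>u. \<lbrakk>u \<in> carrier P; \<sim> y \<sqsubseteq> u; x \<sqsubseteq> u\<rbrakk> \<Longrightarrow> s \<sqsubseteq> u"
    using x y ocompl_closed by (auto simp: least_def Upper_def)
  have "\<sim> s \<sqsubseteq> y" "\<sim> s \<sqsubseteq> \<sim> x"
    using ocompl_antitone[OF _ sc up(1)] ocompl_antitone[OF x sc up(2)]
      ocompl_closed[OF y] ocompl_involution[OF y] by simp_all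
  moreover have "l \<sqsubseteq> \<sim> s" if l: "l \<in> carrier P" "l \<sqsubseteq> y" "l \<sqsubseteq> \<sim> x" for l
  proof -
    have "\<sim> y \<sqsubseteq> \<sim> l" "x \<sqsubseteq> \<sim> l"
      using ocompl_antitone[OF l(1) y l(2)]
        ocompl_antitone[OF l(1) ocompl_closed[OF x] l(3)] ocompl_involution[OF x] by simp_all
    then have "s \<sqsubseteq> \<sim> l" using min ocompl_closed[OF l(1)] by blast
    then show ?thesis
      using ocompl_antitone[OF sc ocompl_closed[OF l(1)]] ocompl_involution[OF l(1)] by simp
  qed
  ultimately have "greatest P (\<sim> s) (Lower P {y, \<sim> x})"
    using sc x y ocompl_closed by (auto simp: greatest_def Lower_def)
  then show ?thesis unfolding meet_def inf_def by (rule someI)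
qed

lemma orthomodular_join:
  assumes x: "x \<in> carrier P" and y: "y \<in> carrier P" and le: "x \<sqsubseteq> y"
  shows "least P (x \<squnion> (y \<sqinter> \<sim> x)) (Upper P {x, y \<sqinter> \<sim> x})"
proof -
  have m: "y \<sqinter> \<sim> x \<in> carrier P" "y \<sqinter> \<sim> x \<sqsubseteq> \<sim> x"
    using orthomodular_meet[OF assms] x y ocompl_closed
    by (auto simp: greatest_def Lower_def)
  have "x \<sqsubseteq> \<sim> (y \<sqinter> \<sim> x)"
    using ocompl_antitone[OF m(1) ocompl_closed[OF x] m(2)] ocompl_involution[OF x] by simp
  then obtain s where "least P s (Upper P {x, y \<sqinter> \<sim> x})"
    using orthogonal_join_exists[OF x m(1)] by blast
  then show ?thesis unfolding join_def[of P x] sup_def by (rule someI)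
qed

end

definition ortho_isomorphic :: "'a ortho_struct \<Rightarrow> 'b ortho_struct \<Rightarrow> bool" where
  "ortho_isomorphic P Q \<longleftrightarrow>
    (\<exists>f. bij_betw f (carrier P) (carrier Q) \<and> order_emb P Q f \<and>
      (\<forall>x\<in>carrier P. f (\<sim>\<^bsub>P\<^esub> x) = \<sim>\<^bsub>Q\<^esub> (f x)))"


section \<open>The 18-element structure\<close>

datatype p0 = p0_zero | p0_one
  | pa | pb | pc | pd | pe | pf | pg | ph
  | pa' | pb' | pc' | pd' | pe' | pf' | pg' | ph'

fun p0_compl :: "p0 \<Rightarrow> p0" where
  "p0_compl p0_zero = p0_one" | "p0_compl p0_one = p0_zero"
| "p0_compl pa = pa'" | "p0_compl pa' = pa"
| "p0_compl pb = pb'" | "p0_compl pb' = pb"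
| "p0_compl pc = pc'" | "p0_compl pc' = pc"
| "p0_compl pd = pd'" | "p0_compl pd' = pd"
| "p0_compl pe = pe'" | "p0_compl pe' = pe"
| "p0_compl pf = pf'" | "p0_compl pf' = pf"
| "p0_compl pg = pg'" | "p0_compl pg' = pg"
| "p0_compl ph = ph'" | "p0_compl ph' = ph"

text \<open>The strict relations between elements other than the bounds.\<close>

definition p0_strict :: "(p0 \<times> p0) set" where
  "p0_strict =
    {pa} \<times> {pd', pf', pg', ph'} \<union> {pb} \<times> {pc', pe', pg', ph'} \<union>
    {pc} \<times> {pb', ph'} \<union> {pd} \<times> {pa', ph'} \<union>
    {pe} \<times> {pb', pg'} \<union> {pf} \<times> {pa', pg'} \<union>
    {pg} \<times> {pa', pb', pe', pf'} \<union> {ph} \<times> {pa', pb', pc', pd'}"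

definition p0_le :: "p0 \<Rightarrow> p0 \<Rightarrow> bool" where
  "p0_le x y \<longleftrightarrow> x = y \<or> x = p0_zero \<or> y = p0_one \<or> (x, y) \<in> p0_strict"

definition P0 :: "p0 ortho_struct" where
  "P0 = \<lparr>carrier = UNIV, eq = (=), le = p0_le,
         ocompl = p0_compl, zero_el = p0_zero, one_el = p0_one\<rparr>"

lemma card_P0: "finite (carrier P0)" "card (carrier P0) = 18"
proof -
  have "(UNIV :: p0 set) = {p0_zero, p0_one, pa, pb, pc, pd, pe, pf, pg, ph,
      pa', pb', pc', pd', pe', pf', pg', ph'}"
    using p0.exhaust by auto
  then have U: "carrier P0 = {p0_zero, p0_one, pa, pb, pc, pd, pe, pf, pg, ph,
      pa', pb', pc', pd', pe', pf', pg', ph'}"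
    by (simp add: P0_def)
  show "finite (carrier P0)" "card (carrier P0) = 18"
    unfolding U by simp_all
qed

end

theory Submission
  imports Defs
begin

text \<open>
  If \<open>x\<close>, \<open>y\<close> have no join in a finite orthomodular poset, they have two distinct minimal upper
  bounds \<open>g'\<close>, \<open>h'\<close>, and \<open>x\<close>, \<open>y\<close> extend to distinct maximal lower bounds \<open>a\<close>, \<open>b\<close> of
  \<open>g'\<close> and \<open>h'\<close>. So \<open>a\<close>, \<open>b\<close> are orthogonal to \<open>g\<close>, \<open>h\<close>, and by maximality nothing nonzero is
  orthogonal to three of \<open>a\<close>, \<open>b\<close>, \<open>g\<close>, \<open>h\<close>. With the corners \<open>c = (b \<squnion> h)'\<close>,
  \<open>d = (a \<squnion> h)'\<close>, \<open>e = (b \<squnion> g)'\<close>, \<open>f = (a \<squnion> g)'\<close> this settles which of the eight elements are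
  orthogonal, except for pairs of corners, and that is enough to separate the eight elements, their
  complements, \<open>0\<close> and \<open>1\<close>. If there are no further elements, two corners cannot be orthogonal
  either, because their join would be a further element; then the whole order is determined.
\<close>

section \<open>Orthogonality\<close>

context orthomodular_poset
begin

abbreviation orthogonal :: "'a \<Rightarrow> 'a \<Rightarrow> bool" (infix \<open>orth\<close> 50) where
  "x orth y \<equiv> x \<sqsubseteq> \<sim> y"

lemma zero_closed: "zero_el P \<in> carrier P"
  and zero_le: "x \<in> carrier P \<Longrightarrow> zero_el P \<sqsubseteq> x"
  using zero_least by (auto simp: least_def)

lemma one_closed: "one_el P \<in> carrier P"
  and le_one: "x \<in> carrier P \<Longrightarrow> x \<sqsubseteq> one_el P"
  using one_greatest by (auto simp: greatest_def)

lemmas closed = zero_closed one_closed ocompl_closed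

lemma le_zero: "x \<in> carrier P \<Longrightarrow> x \<sqsubseteq> zero_el P \<Longrightarrow> x = zero_el P"
  by (simp add: le_antisym zero_le closed)

lemma one_le: "x \<in> carrier P \<Longrightarrow> one_el P \<sqsubseteq> x \<Longrightarrow> x = one_el P"
  by (simp add: le_antisym le_one closed)

lemma ocompl_le_iff:
  assumes "x \<in> carrier P" "y \<in> carrier P"
  shows "\<sim> x \<sqsubseteq> \<sim> y \<longleftrightarrow> y \<sqsubseteq> x"
  using assms ocompl_antitone ocompl_closed ocompl_involution by metis

lemma orthogonal_sym:
  assumes "x \<in> carrier P" "y \<in> carrier P"
  shows "x orth y \<longleftrightarrow> y orth x"
  using assms ocompl_antitone ocompl_closed ocompl_involution by metis

lemma ocompl_zero: "\<sim> zero_el P = one_el P"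
  using closed ocompl_antitone ocompl_involution one_le zero_le by metis

lemma ocompl_one: "\<sim> one_el P = zero_el P"
  using ocompl_zero ocompl_involution closed by metis

lemma self_orthogonal: "x \<in> carrier P \<Longrightarrow> x orth x \<Longrightarrow> x = zero_el P"
  using ocompl_lower[of x] closed by (auto simp: Lower_def set_eq_iff)

lemma le_self_orthogonal:
  assumes "x \<in> carrier P" "y \<in> carrier P" "x \<sqsubseteq> y" "x orth y"
  shows "x = zero_el P"
  using assms self_orthogonal le_trans ocompl_antitone closed by metis

lemma orthogonal_join:
  assumes "x \<in> carrier P" "y \<in> carrier P" "x orth y"
  shows join_closed: "x \<squnion> y \<in> carrier P"
    and join_le_iff: "z \<in> carrier P \<Longrightarrow> x \<squnion> y \<sqsubseteq> z \<longleftrightarrow> x \<sqsubseteq> z \<and> y \<sqsubseteq> z"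
    and join_left: "x \<sqsubseteq> x \<squnion> y"
    and join_right: "y \<sqsubseteq> x \<squnion> y"
proof -
  have "least P (x \<squnion> y) (Upper P {x, y})"
    unfolding join_def sup_def using orthogonal_join_exists[OF assms] by (rule someI_ex)
  then have *: "x \<squnion> y \<in> carrier P" "x \<sqsubseteq> x \<squnion> y" "y \<sqsubseteq> x \<squnion> y"
      "\<And>z. z \<in> carrier P \<Longrightarrow> x \<sqsubseteq> z \<Longrightarrow> y \<sqsubseteq> z \<Longrightarrow> x \<squnion> y \<sqsubseteq> z"
    using assms by (auto simp: least_def Upper_def)
  then show "x \<squnion> y \<in> carrier P" "x \<sqsubseteq> x \<squnion> y" "y \<sqsubseteq> x \<squnion> y" by blast+
  show "z \<in> carrier P \<Longrightarrow> x \<squnion> y \<sqsubseteq> z \<longleftrightarrow> x \<sqsubseteq> z \<and> y \<sqsubseteq> z"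
    using * assms le_trans by metis
qed

lemma join_orthogonal_iff:
  assumes "x \<in> carrier P" "y \<in> carrier P" "x orth y" "z \<in> carrier P"
  shows "x \<squnion> y orth z \<longleftrightarrow> x orth z \<and> y orth z"
  using assms by (simp add: join_le_iff closed)

lemma join_commute: "x \<squnion> y = y \<squnion> x"
  by (simp add: join_def insert_commute)

text \<open>For orthogonal \<open>x\<close>, \<open>y\<close> this is the greatest element
  orthogonal to both; the three elements are pairwise orthogonal and together join to
  \<open>1\<close>.\<close>

abbreviation third :: "'a \<Rightarrow> 'a \<Rightarrow> 'a" where
  "third x y \<equiv> \<sim> (x \<squnion> y)"

lemma orthogonal_third_iff:
  assumes "x \<in> carrier P" "y \<in> carrier P" "x orth y" "z \<in> carrier P"
  shows "z \<sqsubseteq> third x y \<longleftrightarrow> z orth x \<and> z orth y"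
  using assms orthogonal_sym join_orthogonal_iff join_closed by metis

text \<open>This is the orthomodular law for \<open>x \<sqsubseteq> \<sim> y\<close>: by De Morgan
  the meet occurring in it is \<open>third x y\<close>.\<close>

lemma orthogonal_relative_complement:
  assumes "x \<in> carrier P" "y \<in> carrier P" "x orth y"
  shows "y = \<sim> (x \<squnion> \<sim> (x \<squnion> y))"
proof -
  have m: "greatest P (\<sim> y \<sqinter> \<sim> x) (Lower P {\<sim> y, \<sim> x})"
    using orthomodular_meet assms closed by blast
  have third: "third x y \<in> carrier P" "third x y orth x" "third x y orth y"
    using orthogonal_third_iff[OF assms, of "third x y"] join_closed[OF assms] closed le_refl
    by blast+
  have "greatest P (\<sim> (x \<squnion> y)) (Lower P {\<sim> y, \<sim> x})"
    using orthogonal_third_iff[OF assms] third assms by (auto simp: greatest_def Lower_def closed)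
  then have "\<sim> y \<sqinter> \<sim> x = \<sim> (x \<squnion> y)"
    using m greatest_unique by blast
  then show ?thesis
    using orthomodular[OF assms(1) ocompl_closed[OF assms(2)] assms(3)] assms ocompl_involution
    by metis
qed

lemma join_cancel:
  assumes "x \<in> carrier P" "y \<in> carrier P" "z \<in> carrier P" "x orth y" "x orth z" "x \<squnion> y = x \<squnion> z"
  shows "y = z"
  using orthogonal_relative_complement assms by metis

lemma join_eq_one:
  assumes "x \<in> carrier P" "y \<in> carrier P" "x orth y" "x \<squnion> y = one_el P"
  shows "y = \<sim> x"
proof -
  have "y = \<sim> (x \<squnion> zero_el P)"
    using orthogonal_relative_complement[OF assms(1-3)] assms(4) ocompl_one by simp
  moreover have "x \<squnion> zero_el P = x"
    using assms closed zero_le ocompl_zero le_one join_closed join_le_iff join_left le_antisym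
    by (metis le_refl)
  ultimately show ?thesis by simp
qed

lemma join_third:
  assumes "x \<in> carrier P" "y \<in> carrier P" "x orth y"
  shows "x \<squnion> third x y = \<sim> y"
  using assms orthogonal_relative_complement ocompl_involution join_closed closed
    orthogonal_third_iff le_refl orthogonal_sym
  by metis

end

section \<open>The table of the 18-element structure\<close>

text \<open>One corner for each side of the 4-cycle \<open>pa\<close>, \<open>pg\<close>,
  \<open>pb\<close>, \<open>ph\<close>: the third member of the triangle over that side.\<close>

definition p0_corners :: "p0 set" where
  "p0_corners = {pc, pd, pe, pf}"

definition p0_atoms :: "p0 set" where
  "p0_atoms = {pa, pb, pg, ph} \<union> p0_corners"

text \<open>Going through \<open>p0_strict\<close> leaves out the bounds, so this is a graph on the
  eight atoms: a 4-cycle with a triangle attached to each side.\<close>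

definition p0_orth :: "p0 \<Rightarrow> p0 \<Rightarrow> bool" where
  "p0_orth x y \<longleftrightarrow> (x, p0_compl y) \<in> p0_strict"

lemmas p0_table = p0_atoms_def p0_corners_def p0_orth_def p0_strict_def

lemma p0_compl_compl [simp]: "p0_compl (p0_compl x) = x"
  by (cases x) simp_all

lemma p0_compl_eq_iff [simp]: "p0_compl x = p0_compl y \<longleftrightarrow> x = y"
  by (metis p0_compl_compl)

lemma p0_cases:
  obtains "x = p0_zero" | "x = p0_one" | "x \<in> p0_atoms"
    | u where "u \<in> p0_atoms" "x = p0_compl u"
proof -
  have "x = p0_zero \<or> x = p0_one \<or> x \<in> p0_atoms \<or> p0_compl x \<in> p0_atoms"
    by (cases x) (simp_all add: p0_table)
  then show thesis using that p0_compl_compl[of x] by metis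
qed

lemma p0_strict_orth: "(x, y) \<in> p0_strict \<longleftrightarrow> p0_orth x (p0_compl y)"
  by (simp add: p0_orth_def)

lemma p0_orth_atoms: "p0_orth x y \<Longrightarrow> x \<in> p0_atoms \<and> y \<in> p0_atoms"
  by (cases y) (auto simp: p0_table)

lemma p0_orth_sym: "p0_orth x y \<longleftrightarrow> p0_orth y x"
proof -
  have "p0_orth x y \<Longrightarrow> p0_orth y x" for x y
    by (cases y) (auto simp: p0_table)
  then show ?thesis by blast
qed

lemma p0_atoms_not_compl: "x \<in> p0_atoms \<Longrightarrow> p0_compl x \<notin> p0_atoms"
  by (auto simp: p0_table)

lemma p0_orth_irrefl: "\<not> p0_orth x x"
  by (cases x) (simp_all add: p0_table)

lemma p0_le_zero_one:
  "p0_le p0_zero x" "p0_le x p0_one"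
  "p0_le x p0_zero \<longleftrightarrow> x = p0_zero" "p0_le p0_one x \<longleftrightarrow> x = p0_one"
  by (auto simp: p0_le_def p0_strict_def)

lemma p0_atoms_neq:
  "x \<in> p0_atoms \<Longrightarrow> x \<noteq> p0_zero \<and> x \<noteq> p0_one \<and> p0_compl x \<noteq> p0_zero \<and> p0_compl x \<noteq> p0_one"
  by (cases x) (simp_all add: p0_table)

lemma p0_le_atoms:
  assumes "x \<in> p0_atoms" "y \<in> p0_atoms"
  shows "p0_le x y \<longleftrightarrow> x = y"
    and "p0_le x (p0_compl y) \<longleftrightarrow> p0_orth x y"
    and "\<not> p0_le (p0_compl x) y"
    and "p0_le (p0_compl x) (p0_compl y) \<longleftrightarrow> x = y"
  using p0_atoms_neq[OF assms(1)] p0_atoms_neq[OF assms(2)] p0_atoms_not_compl[OF assms(1)]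
    p0_atoms_not_compl[OF assms(2)] assms p0_orth_atoms[of x "p0_compl y"]
    p0_orth_atoms[of "p0_compl x" "p0_compl y"] p0_orth_atoms[of "p0_compl x" y]
  unfolding p0_le_def p0_strict_orth p0_compl_compl p0_compl_eq_iff
  by blast+

lemma p0_corners_atoms: "x \<in> p0_corners \<Longrightarrow> x \<in> p0_atoms"
  by (simp add: p0_atoms_def)

text \<open>Otherwise \<open>y\<close> would be both an atom and the complement of an atom.\<close>

lemma p0_strict_not_trans: "(x, y) \<in> p0_strict \<Longrightarrow> (y, z) \<notin> p0_strict"
  using p0_orth_atoms p0_atoms_not_compl unfolding p0_strict_orth by blast

lemma p0_strict_bounds:
  "(x, y) \<in> p0_strict \<Longrightarrow> x \<noteq> p0_zero \<and> x \<noteq> p0_one \<and> y \<noteq> p0_zero \<and> y \<noteq> p0_one"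
  by (auto simp: p0_strict_def)

lemma p0_le_antisym: "p0_le x y \<Longrightarrow> p0_le y x \<Longrightarrow> x = y"
  unfolding p0_le_def using p0_strict_not_trans p0_strict_bounds by blast

lemma p0_le_trans: "p0_le x y \<Longrightarrow> p0_le y z \<Longrightarrow> p0_le x z"
  unfolding p0_le_def using p0_strict_not_trans p0_strict_bounds by blast

text \<open>Supplies the witness that separates the images of \<open>x\<close> and \<open>y\<close>
  in any square; the last conjunct avoids pairs of corners, whose orthogonality a square leaves
  open.\<close>

lemma p0_separate:
  assumes "x \<in> p0_atoms" "y \<in> p0_atoms" "x \<noteq> y"
  shows "\<exists>z\<in>p0_atoms. p0_orth y z \<and> \<not> p0_orth x z \<and> \<not> (x \<in> p0_corners \<and> z \<in> p0_corners \<and> x \<noteq> z)"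
  using assms unfolding p0_atoms_def p0_corners_def
  by (elim UnE insertE emptyE) (simp_all add: p0_table)

lemma p0_other_neighbour:
  assumes "x \<in> p0_atoms"
  shows "\<exists>z\<in>p0_atoms. p0_orth x z \<and> z \<noteq> y"
  using assms unfolding p0_atoms_def p0_corners_def
  by (elim UnE insertE emptyE; cases y) (simp_all add: p0_table)

lemma p0_corners_not_orth: "x \<in> p0_corners \<Longrightarrow> y \<in> p0_corners \<Longrightarrow> \<not> p0_orth x y"
  by (auto simp: p0_table)

text \<open>Two corners share a neighbour exactly when their sides of the 4-cycle meet, and the side
  of \<open>x\<close> has only one opposite side.\<close>

lemma p0_three_corners:
  assumes "x \<in> p0_corners" "y \<in> p0_corners" "u \<in> p0_corners" "x \<noteq> y" "x \<noteq> u" "y \<noteq> u"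
  shows "\<exists>v. p0_orth x v \<and> (p0_orth y v \<or> p0_orth u v)"
proof -
  have "\<exists>v\<in>p0_atoms. p0_orth x v \<and> (p0_orth y v \<or> p0_orth u v)"
    using assms unfolding p0_corners_def
    by (elim insertE emptyE) (simp_all add: p0_table)
  then show ?thesis by blast
qed

text \<open>The four triangles are edge-disjoint and contain every edge; \<open>t\<close> is the
  table's counterpart of \<open>third\<close>.\<close>

lemma p0_third:
  assumes "p0_orth x y"
  obtains t where "p0_orth x t" "p0_orth y t" "\<And>w. p0_orth x w \<Longrightarrow> p0_orth y w \<Longrightarrow> w = t"
proof -
  have "x \<in> p0_atoms" "y \<in> p0_atoms"
    using assms p0_orth_atoms by auto
  then have "\<exists>t\<in>p0_atoms. p0_orth x t \<and> p0_orth y t \<and>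
      (\<forall>w\<in>p0_atoms. p0_orth x w \<longrightarrow> p0_orth y w \<longrightarrow> w = t)"
    using assms unfolding p0_atoms_def p0_corners_def
    by (elim UnE insertE emptyE) (simp_all add: p0_table)
  then show thesis using that p0_orth_atoms by blast
qed

section \<open>Joins in the 18-element structure and its orthomodularity\<close>

lemma p0_le_compl: "p0_le x y \<Longrightarrow> p0_le (p0_compl y) (p0_compl x)"
  using p0_orth_sym[of x "p0_compl y"] unfolding p0_le_def p0_strict_orth by auto

lemma p0_le_both: "p0_le u x \<Longrightarrow> p0_le u (p0_compl x) \<Longrightarrow> u = p0_zero"
  by (cases x rule: p0_cases; cases u rule: p0_cases)
    (auto simp: p0_le_zero_one p0_le_atoms p0_orth_irrefl)

text \<open>A relation, since some pairs have no join; phrased with \<open>p0_le\<close> so that the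
  table can settle it.\<close>

definition p0_join :: "p0 \<Rightarrow> p0 \<Rightarrow> p0 \<Rightarrow> bool" where
  "p0_join x y s \<longleftrightarrow> p0_le x s \<and> p0_le y s \<and> (\<forall>u. p0_le x u \<and> p0_le y u \<longrightarrow> p0_le s u)"

lemma p0_join_sym: "p0_join x y s \<Longrightarrow> p0_join y x s"
  by (auto simp: p0_join_def)

lemma p0_join_zero: "p0_join x p0_zero x"
  by (auto simp: p0_join_def p0_le_zero_one p0_le_def)

lemma p0_join_compl: "p0_join x (p0_compl x) p0_one"
proof -
  have "u = p0_one" if "p0_le x u" "p0_le (p0_compl x) u" for u
  proof -
    have "p0_compl u = p0_compl p0_one"
      using p0_le_both[OF p0_le_compl[OF that(1)]] p0_le_compl[OF that(2)] by simp
    then show ?thesis by (simp del: p0_compl.simps)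
  qed
  then show ?thesis by (auto simp: p0_join_def p0_le_zero_one)
qed

text \<open>No atom lies above two orthogonal atoms, so an upper bound is \<open>1\<close> or the
  complement of a common neighbour, and \<open>t\<close> is the only one.\<close>

lemma p0_join_orth:
  assumes "p0_orth x t" "p0_orth y t" "p0_orth x y" "\<And>w. p0_orth x w \<Longrightarrow> p0_orth y w \<Longrightarrow> w = t"
  shows "p0_join x y (p0_compl t)"
proof -
  have atoms: "x \<in> p0_atoms" "y \<in> p0_atoms" "t \<in> p0_atoms"
    using p0_orth_atoms[OF assms(1)] p0_orth_atoms[OF assms(2)] by simp_all
  have "p0_le (p0_compl t) u" if "p0_le x u" "p0_le y u" for u
  proof (cases u rule: p0_cases)
    case 1
    then show ?thesis using that(1) atoms(1) p0_atoms_neq by (simp add: p0_le_zero_one)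
  next
    case 2
    then show ?thesis by (simp add: p0_le_zero_one)
  next
    case 3
    then show ?thesis using that atoms assms(3) p0_orth_irrefl by (simp add: p0_le_atoms)
  next
    case (4 w)
    then have "p0_orth x w" "p0_orth y w" using that atoms by (simp_all add: p0_le_atoms)
    then have "w = t" by (rule assms(4))
    then show ?thesis using 4 by (simp add: p0_le_def)
  qed
  then show ?thesis using assms(1,2) atoms by (simp add: p0_join_def p0_le_atoms)
qed

lemma P0_simps [simp]:
  "carrier P0 = UNIV" "le P0 = p0_le" "eq P0 = (=)" "ocompl P0 = p0_compl"
  "zero_el P0 = p0_zero" "one_el P0 = p0_one"
  by (simp_all add: P0_def)

lemma P0_partial_order: "partial_order P0"
  by unfold_locales (auto simp: p0_le_def[of x x for x] intro: p0_le_antisym p0_le_trans)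

lemma least_P0_iff: "least P0 s (Upper P0 {x, y}) \<longleftrightarrow> p0_join x y s"
  by (auto simp: least_def Upper_def p0_join_def)

lemma greatest_P0_iff:
  "greatest P0 s (Lower P0 {x, y}) \<longleftrightarrow> p0_join (p0_compl x) (p0_compl y) (p0_compl s)"
proof -
  have "p0_le (p0_compl x) y \<longleftrightarrow> p0_le (p0_compl y) x"
      "p0_le (p0_compl x) (p0_compl y) \<longleftrightarrow> p0_le y x" for x y
    using p0_le_compl p0_compl_compl by metis+
  then show ?thesis
    unfolding greatest_def Lower_def p0_join_def by auto (metis p0_compl_compl)+
qed

lemma join_P0:
  assumes "p0_join x y s"
  shows "x \<squnion>\<^bsub>P0\<^esub> y = s"
  unfolding join_def sup_def least_P0_iff
  using assms partial_order.least_unique[OF P0_partial_order] least_P0_iff by blast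

lemma meet_P0:
  assumes "p0_join x y s"
  shows "p0_compl x \<sqinter>\<^bsub>P0\<^esub> p0_compl y = p0_compl s"
proof -
  have "greatest P0 (p0_compl s) (Lower P0 {p0_compl x, p0_compl y})"
    using assms by (simp add: greatest_P0_iff)
  then show ?thesis
    unfolding meet_def inf_def
    using partial_order.greatest_unique[OF P0_partial_order] by blast
qed

lemma p0_orthomodular_law:
  assumes "p0_le x y"
  shows "y = x \<squnion>\<^bsub>P0\<^esub> (y \<sqinter>\<^bsub>P0\<^esub> p0_compl x)"
proof -
  consider "x = y" | "x = p0_zero" | "y = p0_one" | v where "p0_orth x v" "y = p0_compl v"
    using assms p0_compl_compl unfolding p0_le_def p0_strict_orth by metis
  then show ?thesis
  proof cases
    case 1
    then show ?thesis
      using meet_P0[OF p0_join_sym[OF p0_join_compl[of x]]] join_P0[OF p0_join_zero[of x]] by simp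
  next
    case 2
    then show ?thesis
      using meet_P0[OF p0_join_zero[of "p0_compl y"]] join_P0[OF p0_join_sym[OF p0_join_zero[of y]]]
      by simp
  next
    case 3
    then show ?thesis
      using meet_P0[OF p0_join_sym[OF p0_join_zero[of x]]] join_P0[OF p0_join_compl[of x]] by simp
  next
    \<comment> \<open>In the triangle \<open>x\<close>, \<open>v\<close>, \<open>t\<close> the meet
      of \<open>p0_compl v\<close> and \<open>p0_compl x\<close> is \<open>t\<close>, and
      \<open>x\<close> joined with \<open>t\<close> is \<open>p0_compl v\<close>.\<close>
    case (4 v)
    obtain t where t: "p0_orth x t" "p0_orth v t" "\<And>w. p0_orth x w \<Longrightarrow> p0_orth v w \<Longrightarrow> w = t"
      using p0_third[OF 4(1)] by blast
    obtain v' where "\<And>w. p0_orth x w \<Longrightarrow> p0_orth t w \<Longrightarrow> w = v'"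
      using p0_third[OF t(1)] by blast
    then have v: "w = v" if "p0_orth x w" "p0_orth t w" for w
      using that 4(1) t(2) p0_orth_sym by metis
    have "p0_join x v (p0_compl t)" "p0_join x t (p0_compl v)"
      using p0_join_orth[of x t v] p0_join_orth[of x v t] t v 4(1) p0_orth_sym by blast+
    then show ?thesis
      using meet_P0[OF p0_join_sym, of x v "p0_compl t"] join_P0[of x t] 4(2) by simp
  qed
qed

lemma P0_orthomodular: "orthomodular_poset P0"
proof -
  have "\<exists>s. p0_join x y s" if le: "p0_le x (p0_compl y)" for x y
  proof -
    consider "x = p0_compl y" | "x = p0_zero" | "y = p0_zero" | "p0_orth x y"
      using le p0_compl_compl unfolding p0_le_def p0_strict_orth by (metis p0_compl.simps(2))
    then show ?thesis
    proof cases
      case 4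
      then show ?thesis using p0_third[OF 4] p0_join_orth by metis
    qed (use p0_join_zero p0_join_compl p0_join_sym in blast)+
  qed
  then have join: "\<exists>s. least P0 s (Upper P0 {x, y})" if "p0_le x (p0_compl y)" for x y
    using that by (simp add: least_P0_iff)
  have "u = p0_one" if "p0_le x u" "p0_le (p0_compl x) u" for x u
    using that p0_join_compl[of x] p0_le_zero_one by (auto simp: p0_join_def)
  then have upper: "Upper P0 {x, p0_compl x} = {p0_one}" for x
    by (auto simp: Upper_def p0_le_zero_one)
  have lower: "Lower P0 {x, p0_compl x} = {p0_zero}" for x
    by (auto simp: Lower_def p0_le_zero_one intro: p0_le_both)
  have bounds: "least P0 p0_zero UNIV" "greatest P0 p0_one UNIV"
    by (simp_all add: least_def greatest_def p0_le_zero_one)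
  show ?thesis
    by (intro orthomodular_poset.intro[OF P0_partial_order] orthomodular_poset_axioms.intro)
      (simp_all add: join upper lower bounds p0_le_compl p0_orthomodular_law[symmetric])
qed

text \<open>Both \<open>pg'\<close> and \<open>ph'\<close> are upper bounds of \<open>pa\<close> and
  \<open>pb\<close>, and no element fits between the two pairs.\<close>

lemma P0_not_lattice: "\<not> lattice P0"
proof
  assume "lattice P0"
  then have "upper_semilattice P0" by (simp add: lattice_def)
  then obtain s where "p0_join pa pb s"
    using upper_semilattice.sup_of_two_exists[of P0 pa pb] least_P0_iff by auto
  then have "p0_le pa s" "p0_le pb s" "p0_le s pg'" "p0_le s ph'"
    by (auto simp: p0_join_def p0_le_def p0_strict_def)
  then show False
    by (cases s) (simp_all add: p0_le_def p0_strict_def)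
qed

section \<open>Orthogonal squares\<close>

text \<open>A 4-cycle of orthogonality with opposite vertices \<open>a\<close>, \<open>b\<close> and
  \<open>g\<close>, \<open>h\<close>. Maximality is imposed on all four, so the hypotheses are
  invariant under every symmetry of the square.\<close>

locale orthogonal_square = orthomodular_poset P for P (structure) +
  fixes a b g h
  assumes square_closed: "a \<in> carrier P" "b \<in> carrier P" "g \<in> carrier P" "h \<in> carrier P"
    and sides: "a orth g" "a orth h" "b orth g" "b orth h"
    and distinct_vertices: "a \<noteq> b" "g \<noteq> h"
    and maximal_a: "\<And>t. \<lbrakk>t \<in> carrier P; t orth g; t orth h; a \<sqsubseteq> t\<rbrakk> \<Longrightarrow> t = a"
    and maximal_b: "\<And>t. \<lbrakk>t \<in> carrier P; t orth g; t orth h; b \<sqsubseteq> t\<rbrakk> \<Longrightarrow> t = b"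
    and maximal_g: "\<And>t. \<lbrakk>t \<in> carrier P; t orth a; t orth b; g \<sqsubseteq> t\<rbrakk> \<Longrightarrow> t = g"
    and maximal_h: "\<And>t. \<lbrakk>t \<in> carrier P; t orth a; t orth b; h \<sqsubseteq> t\<rbrakk> \<Longrightarrow> t = h"
begin

lemmas [simp] = square_closed sides

lemma sides_sym [simp]: "g orth a" "h orth a" "g orth b" "h orth b"
  using sides square_closed orthogonal_sym by blast+

text \<open>With \<open>swap_right\<close> and \<open>swap_diagonals\<close> this generates the
  eight symmetries, so each fact is proved at one place only.\<close>

lemma swap_left: "orthogonal_square P b a g h"
  by unfold_locales (use maximal_a maximal_b maximal_g maximal_h distinct_vertices in auto)

lemma swap_right: "orthogonal_square P a b h g"
  by unfold_locales (use maximal_a maximal_b maximal_g maximal_h distinct_vertices in auto)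

lemma swap_diagonals: "orthogonal_square P g h a b"
  by unfold_locales (use maximal_a maximal_b maximal_g maximal_h distinct_vertices in auto)

text \<open>By maximality \<open>a \<squnion> t\<close> is \<open>a\<close>, so \<open>t\<close>
  lies below \<open>a\<close> while being orthogonal to it.\<close>

lemma orthogonal_agh:
  assumes "t \<in> carrier P" "t orth a" "t orth g" "t orth h"
  shows "t = zero_el P"
proof -
  have "a orth t" using assms orthogonal_sym by simp
  then have "a \<squnion> t = a"
    using maximal_a[of "a \<squnion> t"] assms join_closed join_left join_orthogonal_iff by simp
  then have "t \<sqsubseteq> a"
    using join_right[of a t] \<open>a orth t\<close> assms by simp
  then show ?thesis using le_self_orthogonal[of t a] assms by simp
qed

text \<open>Otherwise \<open>a \<squnion> b\<close> is orthogonal to \<open>g\<close> and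
  \<open>h\<close>, and maximality equates it with both \<open>a\<close> and
  \<open>b\<close>.\<close>

lemma diagonal: "\<not> a orth b"
proof
  assume "a orth b"
  then have "a \<squnion> b \<in> carrier P" "a \<squnion> b orth g" "a \<squnion> b orth h" "a \<sqsubseteq> a \<squnion> b" "b \<sqsubseteq> a \<squnion> b"
    using join_closed join_left join_right by (simp_all add: join_orthogonal_iff)
  then have "a \<squnion> b = a" "a \<squnion> b = b"
    using maximal_a maximal_b by blast+
  then show False using distinct_vertices by simp
qed

lemma a_nonzero: "a \<noteq> zero_el P"
  using diagonal zero_le closed by auto

lemma third_closed: "third a g \<in> carrier P"
  by (simp add: join_closed closed)

lemma third_orthogonal: "third a g orth a" "third a g orth g"
  using orthogonal_third_iff[of a g "third a g"] third_closed le_refl by simp_all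

text \<open>If it vanished, \<open>g\<close> would be the complement of \<open>a\<close>; then
  \<open>b orth g\<close> puts \<open>b\<close> below \<open>a\<close>, against maximality of
  \<open>b\<close>.\<close>

lemma third_nonzero: "third a g \<noteq> zero_el P"
proof
  assume "third a g = zero_el P"
  then have "a \<squnion> g = one_el P"
    using ocompl_involution[of "a \<squnion> g"] join_closed[of a g] ocompl_zero by simp
  then have "g = \<sim> a" by (simp add: join_eq_one)
  then have "b \<sqsubseteq> a" using sides(3) ocompl_involution by simp
  then show False using maximal_b[of a] distinct_vertices by simp
qed

lemma third_not_orthogonal: "\<not> third a g orth h"
  using orthogonal_agh third_closed third_orthogonal third_nonzero by blast

end

section \<open>Transport along the eight symmetries of the square\<close>

context orthogonal_square
begin

interpretation l: orthogonal_square P b a g h by (rule swap_left)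
interpretation r: orthogonal_square P a b h g by (rule swap_right)
interpretation lr: orthogonal_square P b a h g by (rule l.swap_right)
interpretation d: orthogonal_square P g h a b by (rule swap_diagonals)
interpretation dl: orthogonal_square P h g a b by (rule d.swap_left)
interpretation dr: orthogonal_square P g h b a by (rule d.swap_right)
interpretation dlr: orthogonal_square P h g b a by (rule dl.swap_right)

lemma thirds:
  "third b h \<in> carrier P" "third a h \<in> carrier P" "third b g \<in> carrier P" "third a g \<in> carrier P"
  "third b h orth b" "third b h orth h" "third a h orth a" "third a h orth h"
  "third b g orth b" "third b g orth g" "third a g orth a" "third a g orth g"
  "b orth third b h" "h orth third b h" "a orth third a h" "h orth third a h"
  "b orth third b g" "g orth third b g" "a orth third a g" "g orth third a g"
  using third_closed third_orthogonal l.third_closed l.third_orthogonal r.third_closed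
    r.third_orthogonal lr.third_closed lr.third_orthogonal orthogonal_sym
  by simp_all

lemma vertices_nonzero:
  "a \<noteq> zero_el P" "b \<noteq> zero_el P" "g \<noteq> zero_el P" "h \<noteq> zero_el P"
  "third b h \<noteq> zero_el P" "third a h \<noteq> zero_el P" "third b g \<noteq> zero_el P" "third a g \<noteq> zero_el P"
  using a_nonzero l.a_nonzero d.a_nonzero dl.a_nonzero
    third_nonzero l.third_nonzero r.third_nonzero lr.third_nonzero by simp_all

lemma not_orthogonal:
  "\<not> a orth b" "\<not> g orth h" "\<not> b orth a" "\<not> h orth g"
  "\<not> third b h orth a" "\<not> third b h orth g" "\<not> third a h orth b" "\<not> third a h orth g"
  "\<not> third b g orth a" "\<not> third b g orth h" "\<not> third a g orth b" "\<not> third a g orth h"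
  "\<not> a orth third b h" "\<not> g orth third b h" "\<not> b orth third a h" "\<not> g orth third a h"
  "\<not> a orth third b g" "\<not> h orth third b g" "\<not> b orth third a g" "\<not> h orth third a g"
proof -
  note third_not_orthogonal l.third_not_orthogonal r.third_not_orthogonal
    lr.third_not_orthogonal d.third_not_orthogonal dl.third_not_orthogonal
    dr.third_not_orthogonal dlr.third_not_orthogonal
  \<comment> \<open>Exchanging the diagonals yields \<open>third g a\<close> in place of
    \<open>third a g\<close>; commutativity restores one normal form.\<close>
  note this[unfolded join_commute[of g] join_commute[of h]]
  then show
    "\<not> third b h orth a" "\<not> third b h orth g" "\<not> third a h orth b" "\<not> third a h orth g"
    "\<not> third b g orth a" "\<not> third b g orth h" "\<not> third a g orth b" "\<not> third a g orth h"
    by blast+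
  then show
    "\<not> a orth third b h" "\<not> g orth third b h" "\<not> b orth third a h" "\<not> g orth third a h"
    "\<not> a orth third b g" "\<not> h orth third b g" "\<not> b orth third a g" "\<not> h orth third a g"
    using thirds(1-4) square_closed orthogonal_sym by metis+
qed (use diagonal d.diagonal l.diagonal dl.diagonal in simp_all)

lemma not_self_orthogonal:
  "\<not> a orth a" "\<not> b orth b" "\<not> g orth g" "\<not> h orth h" "\<not> third b h orth third b h"
  "\<not> third a h orth third a h" "\<not> third b g orth third b g" "\<not> third a g orth third a g"
  using vertices_nonzero self_orthogonal thirds square_closed by blast+

end

section \<open>Embedding of the 18-element structure given by a square\<close>

context orthogonal_square
begin

primrec emb :: "p0 \<Rightarrow> 'a" where
  "emb p0_zero = zero_el P" | "emb p0_one = one_el P"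
| "emb pa = a" | "emb pa' = \<sim> a"
| "emb pb = b" | "emb pb' = \<sim> b"
| "emb pc = third b h" | "emb pc' = \<sim> third b h"
| "emb pd = third a h" | "emb pd' = \<sim> third a h"
| "emb pe = third b g" | "emb pe' = \<sim> third b g"
| "emb pf = third a g" | "emb pf' = \<sim> third a g"
| "emb pg = g" | "emb pg' = \<sim> g"
| "emb ph = h" | "emb ph' = \<sim> h"

lemma emb_closed: "emb x \<in> carrier P"
  by (cases x) (simp_all add: closed thirds)

lemma emb_compl: "emb (p0_compl x) = \<sim> emb x"
  by (cases x) (simp_all add: ocompl_involution ocompl_zero ocompl_one thirds)

lemma emb_orth:
  assumes "p0_orth x y"
  shows "emb x orth emb y"
proof -
  have "x \<in> p0_atoms" "y \<in> p0_atoms"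
    using assms p0_orth_atoms by auto
  then show ?thesis
    using assms unfolding p0_atoms_def p0_corners_def
    by (elim UnE insertE emptyE) (simp_all add: p0_table thirds)
qed

lemma emb_not_orth:
  assumes "x \<in> p0_atoms" "y \<in> p0_atoms" "\<not> p0_orth x y"
    and "\<not> (x \<in> p0_corners \<and> y \<in> p0_corners \<and> x \<noteq> y)"
  shows "\<not> emb x orth emb y"
  using assms unfolding p0_atoms_def p0_corners_def
  by (elim UnE insertE emptyE) (simp_all add: p0_table not_orthogonal not_self_orthogonal)

lemma emb_nonzero: "x \<in> p0_atoms \<Longrightarrow> emb x \<noteq> zero_el P"
  by (auto simp: p0_table vertices_nonzero)

text \<open>For \<open>x \<noteq> y\<close> the witness \<open>z\<close> of
  \<open>p0_separate\<close> gives
  \<open>emb x \<sqsubseteq> emb y \<sqsubseteq> \<sim> emb z\<close>, which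
  \<open>emb_not_orth\<close> excludes.\<close>

lemma emb_le_atoms:
  assumes "x \<in> p0_atoms" "y \<in> p0_atoms" "emb x \<sqsubseteq> emb y"
  shows "x = y"
proof (rule ccontr)
  assume "x \<noteq> y"
  then obtain z where z: "z \<in> p0_atoms" "p0_orth y z" "\<not> p0_orth x z"
      "\<not> (x \<in> p0_corners \<and> z \<in> p0_corners \<and> x \<noteq> z)"
    using p0_separate assms by blast
  have "emb x orth emb z"
    using le_trans[OF assms(3) emb_orth[OF z(2)]] by (simp add: emb_closed closed)
  then show False using emb_not_orth assms z by blast
qed

text \<open>Some neighbour \<open>z \<noteq> y\<close> of \<open>x\<close> would have its image
  below \<open>\<sim> emb x\<close> and hence below \<open>emb y\<close>.\<close>

lemma emb_compl_not_le:
  assumes "x \<in> p0_atoms" "y \<in> p0_atoms"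
  shows "\<not> \<sim> emb x \<sqsubseteq> emb y"
proof
  assume *: "\<sim> emb x \<sqsubseteq> emb y"
  obtain z where z: "z \<in> p0_atoms" "p0_orth x z" "z \<noteq> y"
    using p0_other_neighbour assms by blast
  then have "emb z \<sqsubseteq> \<sim> emb x"
    using emb_orth p0_orth_sym by blast
  then have "emb z \<sqsubseteq> emb y"
    using le_trans[OF _ *] by (simp add: emb_closed closed)
  then show False using emb_le_atoms z assms by blast
qed

lemma zero_neq_one: "zero_el P \<noteq> one_el P"
  using vertices_nonzero(1) le_one[of a] le_zero[of a] by auto

lemma emb_neq_one: "x \<in> p0_atoms \<Longrightarrow> emb x \<noteq> one_el P"
  using emb_compl_not_le[of x x] le_one[of "\<sim> emb x"] by (auto simp: emb_closed closed)

lemma emb_mono: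
  assumes "p0_le x y"
  shows "emb x \<sqsubseteq> emb y"
proof -
  consider "x = y" | "x = p0_zero" | "y = p0_one" | "p0_orth x (p0_compl y)"
    using assms unfolding p0_le_def p0_strict_orth by blast
  then show ?thesis
  proof cases
    case 4
    then show ?thesis using emb_orth[OF 4] by (simp add: emb_compl ocompl_involution emb_closed)
  qed (simp_all add: emb_closed zero_le le_one)
qed


lemma emb_eq_zero: "emb x = zero_el P \<longleftrightarrow> x = p0_zero"
  and emb_eq_one: "emb x = one_el P \<longleftrightarrow> x = p0_one"
proof -
  have compl: "emb x = zero_el P \<longleftrightarrow> emb (p0_compl x) = one_el P" for x
    using emb_compl p0_compl_compl ocompl_zero ocompl_one by metis
  have zero: "x = p0_zero" if "emb x = zero_el P" for x
  proof (cases x rule: p0_cases)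
    case 2
    then show ?thesis using that zero_neq_one by simp
  next
    case 3
    then show ?thesis using that emb_nonzero by simp
  next
    case (4 u)
    then show ?thesis using that compl[of x] emb_neq_one by simp
  qed
  then have "x = p0_one" if "emb x = one_el P" for x
    using that compl[of "p0_compl x"] p0_compl_compl[of x] by (metis p0_compl.simps(1))
  then show "emb x = zero_el P \<longleftrightarrow> x = p0_zero" "emb x = one_el P \<longleftrightarrow> x = p0_one"
    using zero by auto
qed

text \<open>The table leaves open only whether two different corners are orthogonal.\<close>

lemma emb_le_cases:
  assumes "emb x \<sqsubseteq> emb y"
  shows "p0_le x y \<or>
    (\<exists>v. x \<in> p0_corners \<and> v \<in> p0_corners \<and> x \<noteq> v \<and> y = p0_compl v \<and> emb x orth emb v)"
proof (cases x rule: p0_cases)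
  case 1
  then show ?thesis by (simp add: p0_le_zero_one)
next
  case 2
  then show ?thesis using assms one_le[OF emb_closed] by (simp add: p0_le_zero_one emb_eq_one)
next
  case x: 3
  show ?thesis
  proof (cases y rule: p0_cases)
    case 1
    then show ?thesis using assms x le_zero[OF emb_closed] emb_nonzero[of x] by simp
  next
    case 2
    then show ?thesis by (simp add: p0_le_zero_one)
  next
    case 3
    then show ?thesis using assms x emb_le_atoms by (auto simp: p0_le_atoms)
  next
    case (4 v)
    then have "emb x orth emb v" using assms by (simp add: emb_compl)
    then show ?thesis using 4 x emb_not_orth[of x v] by (auto simp: p0_le_atoms)
  qed
next
  case x: (4 u)
  show ?thesis
  proof (cases y rule: p0_cases)
    case 1
    then show ?thesis using assms le_zero[OF emb_closed] by (simp add: p0_le_zero_one emb_eq_zero)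
  next
    case 2
    then show ?thesis by (simp add: p0_le_zero_one)
  next
    case 3
    then show ?thesis using assms x emb_compl_not_le by (simp add: emb_compl)
  next
    case (4 v)
    then show ?thesis
      using assms x emb_le_atoms[of v u]
      by (simp add: emb_compl ocompl_le_iff emb_closed p0_le_def)
  qed
qed

text \<open>In the exceptional alternative of \<open>emb_le_cases\<close>, \<open>x\<close> is an
  atom and \<open>y\<close> the complement of one, so the reverse inequality fails.\<close>

lemma inj_emb: "inj emb"
proof (rule injI)
  fix x y
  assume "emb x = emb y"
  then have "emb x \<sqsubseteq> emb y" "emb y \<sqsubseteq> emb x"
    using emb_closed by auto
  then show "x = y"
    using emb_le_cases[of x y] emb_le_cases[of y x] p0_atoms_not_compl p0_le_antisym
      p0_le_atoms(3) p0_corners_atoms by blast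
qed

section \<open>Corners when there are no further elements\<close>

lemma corner_join:
  assumes "x \<in> p0_corners" "p0_orth x v" "p0_orth x t" "v \<noteq> t"
  shows "emb x \<squnion> emb t = \<sim> emb v"
proof -
  \<comment> \<open>A third joined with either of its defining elements is the complement of the
    other, by \<open>join_third\<close>.\<close>
  have *: "third x y \<squnion> x = \<sim> y" "third x y \<squnion> y = \<sim> x"
    if "x \<in> carrier P" "y \<in> carrier P" "x orth y" for x y
    using that join_third[of x y] join_third[of y x] orthogonal_sym[of x y]
    by (simp_all add: join_commute)
  have "v \<in> p0_atoms" "t \<in> p0_atoms"
    using assms p0_orth_atoms by auto
  then show ?thesis
    using assms unfolding p0_atoms_def p0_corners_def
    by (elim UnE insertE emptyE) (simp_all add: p0_table *)
qed

text \<open>Surjectivity puts the join of two orthogonal corners into the table, where it can only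
  be the complement of an atom \<open>u\<close>; every position of \<open>u\<close> is
  contradictory.\<close>

lemma corners_not_orth:
  assumes surj: "carrier P \<subseteq> range emb"
    and xy: "x \<in> p0_corners" "y \<in> p0_corners" "x \<noteq> y"
  shows "\<not> emb x orth emb y"
proof -
  have join: "\<exists>u\<in>p0_atoms. emb x \<squnion> emb y = \<sim> emb u \<and> emb x orth emb u \<and> emb y orth emb u"
    if "x \<in> p0_corners" "y \<in> p0_corners" "x \<noteq> y" "emb x orth emb y" for x y
  proof -
    note emb_closed [simp]
    have atoms: "x \<in> p0_atoms" "y \<in> p0_atoms"
      using that p0_corners_atoms by auto
    have "emb x \<squnion> emb y \<in> range emb"
      using surj join_closed[of "emb x" "emb y"] that(4) by auto
    then obtain w where w: "emb w = emb x \<squnion> emb y" by auto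
    have le: "emb x \<sqsubseteq> emb w" "emb y \<sqsubseteq> emb w"
      using that w by (simp_all add: join_left join_right)
    show ?thesis
    proof (cases w rule: p0_cases)
      case 1
      then show ?thesis using le(1) le_zero[of "emb x"] emb_nonzero[OF atoms(1)] by simp
    next
      case 2
      then have "emb y = \<sim> emb x"
        using join_eq_one[of "emb x" "emb y"] that w by simp
      then have "y = p0_compl x"
        using inj_emb by (simp add: emb_compl[symmetric] inj_eq)
      then show ?thesis using atoms p0_atoms_not_compl by blast
    next
      case 3
      then show ?thesis using le emb_le_atoms atoms that(3) by metis
    next
      case (4 u)
      then have u: "\<sim> emb u = emb x \<squnion> emb y" using w by (simp add: emb_compl)
      show ?thesis
      proof (rule bexI[OF _ 4(1)], unfold u)
        show "emb x \<squnion> emb y = emb x \<squnion> emb y \<and> emb x \<sqsubseteq> emb x \<squnion> emb y \<and> emb y \<sqsubseteq> emb x \<squnion> emb y"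
          using le w by simp
      qed
    qed
  qed
  \<comment> \<open>For corners with a common neighbour \<open>v\<close> the join must be
    \<open>\<sim> emb v\<close>. This is also the join of \<open>emb x\<close> with the image of its
    other neighbour \<open>t\<close>, so cancellation gives \<open>y = t\<close>, but corners are
    never neighbours in the table.\<close>
  have adjacent: "\<not> emb x orth emb y"
    if asm: "x \<in> p0_corners" "y \<in> p0_corners" "x \<noteq> y" "p0_orth x v" "p0_orth y v" for x y v
  proof
    note emb_closed [simp]
    assume orth: "emb x orth emb y"
    have v: "v \<in> p0_atoms" "emb x orth emb v" "emb y orth emb v"
      using asm(4,5) p0_orth_atoms emb_orth by blast+
    obtain u where u: "u \<in> p0_atoms" "emb x \<squnion> emb y = \<sim> emb u"
      using join asm orth by blast
    have "\<sim> emb u \<sqsubseteq> \<sim> emb v"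
      using v orth u(2) join_le_iff[of "emb x" "emb y" "\<sim> emb v"] by (simp add: closed)
    then have "v = u"
      using emb_le_atoms[of v u] v(1) u(1) by (simp add: ocompl_le_iff)
    obtain t where t: "p0_orth x t" "t \<noteq> v"
      using p0_other_neighbour asm p0_corners_atoms by blast
    then have "emb x \<squnion> emb y = emb x \<squnion> emb t"
      using corner_join[of x v t] asm u \<open>v = u\<close> by simp
    then have "y = t"
      using join_cancel[of "emb x" "emb y" "emb t"] orth emb_orth[OF t(1)] inj_emb
      by (simp add: inj_eq)
    then show False using t(1) asm p0_corners_not_orth by blast
  qed
  show ?thesis
  proof
    assume orth: "emb x orth emb y"
    obtain u where u: "u \<in> p0_atoms" "emb x orth emb u" "emb y orth emb u"
      using join xy orth by blast
    show False
    proof (cases "u \<in> p0_corners")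
      \<comment> \<open>Three pairwise orthogonal corners arise, and \<open>x\<close> shares a
        neighbour with one of the other two.\<close>
      case True
      have "u \<noteq> x" "u \<noteq> y"
        using u emb_not_orth[of u u] p0_orth_irrefl by blast+
      then obtain v where "p0_orth x v" "p0_orth y v \<or> p0_orth u v"
        using p0_three_corners[of x y u] xy True by blast
      then show False using adjacent[of x y v] adjacent[of x u v] orth u xy True \<open>u \<noteq> x\<close> by blast
    next
      \<comment> \<open>The table decides orthogonality of a corner and a non-corner, so
        \<open>u\<close> is a common neighbour of \<open>x\<close> and \<open>y\<close>.\<close>
      case False
      then have "p0_orth x u" "p0_orth y u"
        using u xy emb_not_orth p0_corners_atoms by blast+
      then show False using adjacent orth xy by blast
    qed
  qed
qed

lemma card_ge: "finite (carrier P) \<Longrightarrow> card (carrier P) \<ge> 18"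
  using card_inj_on_le[of emb UNIV "carrier P"] inj_emb emb_closed card_P0
  by auto

end

lemma orthogonal_square_ortho_isomorphic:
  fixes P :: "'a ortho_struct"
  assumes "orthogonal_square P a b g h" and card: "card (carrier P) = 18"
  shows "ortho_isomorphic P P0"
proof -
  interpret orthogonal_square P a b g h by fact
  have "finite (carrier P)"
    using card card.infinite by fastforce
  moreover have "card (range emb) = card (carrier P)"
    using card_image[OF inj_emb] card_P0 card by simp
  ultimately have range: "range emb = carrier P"
    using emb_closed by (intro card_subset_eq) auto
  \<comment> \<open>Surjectivity excludes the exceptional alternative of
    \<open>emb_le_cases\<close>.\<close>
  have le: "emb x \<sqsubseteq>\<^bsub>P\<^esub> emb y \<longleftrightarrow> p0_le x y" for x y
    using emb_le_cases[of x y] emb_mono[of x y] corners_not_orth range by blast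
  have right: "emb (inv emb x) = x" if "x \<in> carrier P" for x
    using that range by (auto intro: f_inv_into_f)
  have "bij_betw (inv emb) (carrier P) (carrier P0)"
    using bij_betw_inv_into[of emb UNIV "carrier P"] inj_emb range
    by (simp add: bij_betw_def)
  moreover have "p0_le (inv emb x) (inv emb y) \<longleftrightarrow> x \<sqsubseteq>\<^bsub>P\<^esub> y"
    if "x \<in> carrier P" "y \<in> carrier P" for x y
    using that le[of "inv emb x" "inv emb y"] right by simp
  then have "order_emb P P0 (inv emb)"
    using P0_partial_order weak_partial_order_axioms
    by (simp add: order_emb_def partial_order_def)
  moreover have "inv emb (\<sim>\<^bsub>P\<^esub> x) = p0_compl (inv emb x)" if "x \<in> carrier P" for x
    using that right emb_compl inj_emb by (metis inv_f_f)
  ultimately show ?thesis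
    by (auto simp: ortho_isomorphic_def)
qed

section \<open>Squares in finite non-lattices\<close>

context orthomodular_poset
begin

lemma minimal_below:
  assumes "finite A" "A \<subseteq> carrier P" "w \<in> A"
  obtains m where "m \<in> A" "m \<sqsubseteq> w" "\<And>z. z \<in> A \<Longrightarrow> z \<sqsubseteq> m \<Longrightarrow> z = m"
proof -
  let ?R = "\<lambda>x y. x \<sqsubseteq> y \<and> x \<noteq> y" and ?B = "{z \<in> A. z \<sqsubseteq> w}"
  have B: "?B \<subseteq> carrier P" using assms by auto
  have "transp_on ?B ?R"
  proof (rule transp_onI)
    fix x y z
    assume "x \<in> ?B" "y \<in> ?B" "z \<in> ?B" "?R x y" "?R y z"
    then show "?R x z" using B le_trans[of x y z] le_antisym[of x y] by blast
  qed
  moreover have "asymp_on ?B ?R"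
    using B le_antisym by (intro asymp_onI) blast
  moreover have "finite ?B" "w \<in> ?B"
    using assms by auto
  ultimately obtain m where m: "m \<in> ?B" "\<forall>z\<in>?B. z \<noteq> m \<longrightarrow> \<not> ?R z m"
    using Finite_Set.bex_min_element[of ?B ?R] by blast
  have "z = m" if "z \<in> A" "z \<sqsubseteq> m" for z
  proof -
    have "z \<sqsubseteq> w"
      using that m assms le_trans[of z m w] by blast
    then show ?thesis using that m by blast
  qed
  then show thesis using that m by blast
qed

text \<open>Complementation reduces this to \<open>minimal_below\<close> for the image of
  \<open>A\<close>.\<close>

lemma maximal_above:
  assumes "finite A" "A \<subseteq> carrier P" "w \<in> A"
  obtains m where "m \<in> A" "w \<sqsubseteq> m" "\<And>z. z \<in> A \<Longrightarrow> m \<sqsubseteq> z \<Longrightarrow> z = m"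
proof -
  have A: "\<sim> (\<sim> z) = z" "\<sim> z \<in> carrier P" if "z \<in> A" for z
    using that assms ocompl_involution closed by auto
  obtain m where m: "m \<in> ocompl P ` A" "m \<sqsubseteq> \<sim> w" "\<And>z. z \<in> ocompl P ` A \<Longrightarrow> z \<sqsubseteq> m \<Longrightarrow> z = m"
  proof (rule minimal_below[of "ocompl P ` A" "\<sim> w"])
    show "ocompl P ` A \<subseteq> carrier P" using A by auto
  qed (use assms in auto)
  then obtain n where n: "n \<in> A" "m = \<sim> n" by blast
  show thesis
  proof (rule that[of n])
    show "w \<sqsubseteq> n" using m(2) n assms ocompl_le_iff[of n w] by auto
    show "z = n" if "z \<in> A" "n \<sqsubseteq> z" for z
    proof -
      have "\<sim> z = m"
        using that m(3)[of "\<sim> z"] n assms(2) ocompl_le_iff[of z n] by blast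
      then show ?thesis using A[OF that(1)] A[OF n(1)] n(2) by metis
    qed
  qed (rule n)
qed

lemma no_join_square:
  assumes fin: "finite (carrier P)" and xy: "x \<in> carrier P" "y \<in> carrier P"
    and no_join: "\<nexists>s. least P s (Upper P {x, y})"
  obtains a b g h where "orthogonal_square P a b g h"
proof -
  let ?U = "{u \<in> carrier P. x \<sqsubseteq> u \<and> y \<sqsubseteq> u}"
  have U: "Upper P {x, y} = ?U"
    using xy by (auto simp: Upper_def)
  have finU: "finite ?U" using fin by simp
  have "one_el P \<in> ?U" using xy le_one closed by simp
  then obtain u where u: "u \<in> ?U" "\<And>z. z \<in> ?U \<Longrightarrow> z \<sqsubseteq> u \<Longrightarrow> z = u"
    using minimal_below[OF finU, of "one_el P"] by blast
  \<comment> \<open>As \<open>u\<close> is not the join, some upper bound \<open>w\<close> is not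
    above it; a minimal upper bound below \<open>w\<close> then differs from
    \<open>u\<close>.\<close>
  obtain w where w: "w \<in> ?U" "\<not> u \<sqsubseteq> w"
    using no_join u(1) unfolding U least_def by blast
  obtain v where v: "v \<in> ?U" "v \<sqsubseteq> w" "\<And>z. z \<in> ?U \<Longrightarrow> z \<sqsubseteq> v \<Longrightarrow> z = v"
    using minimal_below[OF finU _ w(1)] by blast
  have uv: "u \<noteq> v" using v w by auto
  let ?L = "{t \<in> carrier P. t \<sqsubseteq> u \<and> t \<sqsubseteq> v}"
  have finL: "finite ?L" using fin by simp
  obtain a where a: "a \<in> ?L" "x \<sqsubseteq> a" "\<And>z. z \<in> ?L \<Longrightarrow> a \<sqsubseteq> z \<Longrightarrow> z = a"
    using maximal_above[OF finL, of x] u(1) v(1) xy by blast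
  obtain b where b: "b \<in> ?L" "y \<sqsubseteq> b" "\<And>z. z \<in> ?L \<Longrightarrow> b \<sqsubseteq> z \<Longrightarrow> z = b"
    using maximal_above[OF finL, of y] u(1) v(1) xy by blast
  have carr: "a \<in> carrier P" "b \<in> carrier P" "u \<in> carrier P" "v \<in> carrier P"
    using a b u v by auto
  \<comment> \<open>Otherwise \<open>a\<close> is an upper bound of \<open>x\<close>,
    \<open>y\<close> below both minimal ones, hence equal to both.\<close>
  have ab: "a \<noteq> b"
  proof
    assume "a = b"
    then have "a \<in> ?U" using a b by auto
    then show False using a(1) u(2)[of a] v(3)[of a] uv by simp
  qed
  \<comment> \<open>This yields maximality of \<open>\<sim> u\<close> and \<open>\<sim> v\<close>:
    since \<open>x \<sqsubseteq> a\<close> and \<open>y \<sqsubseteq> b\<close>, the complement of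
    \<open>t\<close> is an upper bound of \<open>x\<close>, \<open>y\<close> below the minimal one
    \<open>w\<close>.\<close>
  have mini: "t = \<sim> w"
    if "w \<in> ?U" "\<And>z. z \<in> ?U \<Longrightarrow> z \<sqsubseteq> w \<Longrightarrow> z = w" "t \<in> carrier P" "t orth a" "t orth b" "\<sim> w \<sqsubseteq> t"
    for t w
  proof -
    have w: "w \<in> carrier P" using that(1) by simp
    have "x \<sqsubseteq> \<sim> t" "y \<sqsubseteq> \<sim> t"
      using le_trans[OF a(2), of "\<sim> t"] le_trans[OF b(2), of "\<sim> t"]
        orthogonal_sym[of t a] orthogonal_sym[of t b] that(3-5) xy carr closed
      by simp_all
    moreover have "\<sim> t \<sqsubseteq> w"
      using that(3,6) ocompl_antitone[of "\<sim> w" t] ocompl_involution[OF w] ocompl_closed[OF w]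
      by simp
    ultimately have "\<sim> t = w" using that(2)[of "\<sim> t"] that(3) closed by simp
    then show ?thesis using ocompl_involution[OF that(3)] by simp
  qed
  have "orthogonal_square P a b (\<sim> u) (\<sim> v)"
  proof
    show "\<sim> u \<noteq> \<sim> v" using uv carr ocompl_involution by metis
    show "t = a" if "t \<in> carrier P" "t orth \<sim> u" "t orth \<sim> v" "a \<sqsubseteq> t" for t
      using a(3)[of t] that carr by (simp add: ocompl_involution)
    show "t = b" if "t \<in> carrier P" "t orth \<sim> u" "t orth \<sim> v" "b \<sqsubseteq> t" for t
      using b(3)[of t] that carr by (simp add: ocompl_involution)
    show "t = \<sim> u" if "t \<in> carrier P" "t orth a" "t orth b" "\<sim> u \<sqsubseteq> t" for t
      using mini[OF u that] .
    show "t = \<sim> v" if "t \<in> carrier P" "t orth a" "t orth b" "\<sim> v \<sqsubseteq> t" for t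
      using mini[OF v(1,3) that] .
  qed (use a(1) b(1) carr ab in \<open>simp_all add: closed ocompl_involution\<close>)
  then show thesis by (rule that)
qed

lemma non_lattice_square:
  assumes "finite (carrier P)" "\<not> lattice P"
  obtains a b g h where "orthogonal_square P a b g h"
proof -
  have "\<exists>x\<in>carrier P. \<exists>y\<in>carrier P. \<nexists>s. least P s (Upper P {x, y})"
  proof (rule ccontr)
    assume "\<not> ?thesis"
    then have join: "\<exists>s. least P s (Upper P {x, y})" if "x \<in> carrier P" "y \<in> carrier P" for x y
      using that by blast
    \<comment> \<open>Meets are complements of joins of complements, so a poset that is not a
      lattice must lack some join.\<close>
    have "\<exists>s. greatest P s (Lower P {x, y})" if xy: "x \<in> carrier P" "y \<in> carrier P" for x y
    proof -
      obtain s where "least P s (Upper P {\<sim> x, \<sim> y})"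
        using join[of "\<sim> x" "\<sim> y"] xy closed by blast
      then have s: "s \<in> carrier P" "\<sim> x \<sqsubseteq> s" "\<sim> y \<sqsubseteq> s"
          "\<And>u. \<lbrakk>u \<in> carrier P; \<sim> x \<sqsubseteq> u; \<sim> y \<sqsubseteq> u\<rbrakk> \<Longrightarrow> s \<sqsubseteq> u"
        using xy closed by (auto simp: least_def Upper_def)
      have "\<sim> s \<sqsubseteq> x" "\<sim> s \<sqsubseteq> y"
        using s(1-3) xy ocompl_le_iff[of x "\<sim> s"] ocompl_le_iff[of y "\<sim> s"]
        by (simp_all add: closed ocompl_involution)
      moreover have "l \<sqsubseteq> \<sim> s" if "l \<in> carrier P" "l \<sqsubseteq> x" "l \<sqsubseteq> y" for l
        using that xy s(1) s(4)[of "\<sim> l"] ocompl_antitone closed orthogonal_sym[of s l] by simp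
      ultimately show ?thesis
        using s(1) xy by (intro exI[of _ "\<sim> s"]) (auto simp: greatest_def Lower_def closed)
    qed
    then have "lattice P" using join by unfold_locales
    then show False using assms by blast
  qed
  then show thesis using no_join_square assms that by blast
qed

end

text \<open>Since \<open>card\<close> is 0 on infinite sets, the lower bound speaks of finite
  carriers, while \<open>card (carrier P) = 18\<close> already implies finiteness.\<close>

theorem theorem3p1:
  shows "orthomodular_poset P0 \<and> \<not> lattice P0 \<and>
    (\<forall>P :: 'a ortho_struct. orthomodular_poset P \<and> \<not> lattice P \<longrightarrow>
       (finite (carrier P) \<longrightarrow> card (carrier P) \<ge> 18) \<and>
       (card (carrier P) = 18 \<longrightarrow> ortho_isomorphic P P0))"
proof (intro conjI allI impI; (elim conjE)?)
  show "orthomodular_poset P0" by (rule P0_orthomodular)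
  show "\<not> lattice P0" by (rule P0_not_lattice)
next
  fix P :: "'a ortho_struct"
  assume P: "orthomodular_poset P" "\<not> lattice P" and fin: "finite (carrier P)"
  then obtain a b g h where "orthogonal_square P a b g h"
    using orthomodular_poset.non_lattice_square by metis
  then show "18 \<le> card (carrier P)"
    using orthogonal_square.card_ge fin by metis
next
  fix P :: "'a ortho_struct"
  assume P: "orthomodular_poset P" "\<not> lattice P" and card: "card (carrier P) = 18"
  have "finite (carrier P)"
    using card card.infinite by fastforce
  then obtain a b g h where "orthogonal_square P a b g h"
    using orthomodular_poset.non_lattice_square P by metis
  then show "ortho_isomorphic P P0"
    using orthogonal_square_ortho_isomorphic card by metis
qed

end
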